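(* Let $\Omega$ be a nonempty finite set. Every subgroup of $\operatorname{Sym}(\Omega)$ has a perfect refiner in extended graph backtracking, that is, with $\mathcal{O}$ the set of all extended graphs on $\Omega$.
   Context: Actions are right actions, written by exponentiation. A digraph on a set $V$ is a pair $(V,A)$ with arc set $A \subseteq V\times V$ (loops allowed). A labelled digraph on $V$ is a digraph on $V$ together with an assignment of a label, from a fixed infinite set of labels, to each vertex and each arc. $\operatorname{Sym}(V)$ acts on labelled digraphs on $V$ by renaming vertices (vertices and arcs carry their labels along). Fix an infinite well-ordered set $\Lambda\supseteq\Omega$ with $\alpha<\beta$ for all $\alpha\in\Omega$, $\beta\in\Lambda\setminus\Omega$. For $\Omega\subseteq V\subseteq\Lambda$, regard $\operatorname{Sym}(\Omega)$ and $\operatorname{Sym}(V\setminus\Omega)$ as (commuting) subgroups of $\operatorname{Sym}(V)$, acting trivially outside $\Omega$ and $V\setminus\Omega$ respectively. An extended graph on $\Omega$ is an orbit $\overline{\Gamma}$ of $\operatorname{Sym}(V\setminus\Omega)$ on the set of labelled digraphs on $V$, for some finite $V$ with $\Omega\subseteq V\subseteq\Lambda$; here $\overline{\Gamma}$ denotes the orbit of $\Gamma$. $\operatorname{Sym}(\Omega)$ acts on extended graphs by $(\overline{\Gamma})^g=\overline{\Gamma^g}$. For a set $\mathcal{O}$ on which $\operatorname{Sym}(\Omega)$ acts, $\operatorname{Stacks}(\mathcal{O})$ is the set of all finite lists (including the empty one) with entries in $\mathcal{O}$, on which $\operatorname{Sym}(\Omega)$ acts entrywise; $|S|$ is the length of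 a list $S$ and $S \Vert T$ is concatenation. For $x,y$ in a set on which $\operatorname{Sym}(\Omega)$ acts, $\operatorname{Transp}(x,y) = \{g\in\operatorname{Sym}(\Omega) : x^g=y\}$. A refiner for $U\subseteq\operatorname{Sym}(\Omega)$ (with respect to $\mathcal{O}$) is a pair $(f_L,f_R)$ of functions from $\operatorname{Stacks}(\mathcal{O})$ to itself such that $U\cap\operatorname{Transp}(S,T)\subseteq\operatorname{Transp}(f_L(S),f_R(T))$ for all $S,T\in\operatorname{Stacks}(\mathcal{O})$. It is a perfect refiner for $U$ if $U\cap\operatorname{Transp}(S,T)=\operatorname{Transp}(S\Vert f_L(S),\,T\Vert f_R(T))$ for all $S,T\in\operatorname{Stacks}(\mathcal{O})$ with $|S|=|T|$. *)

theory Defs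
  imports
    "HOL-Algebra.Group_Action"
    "HOL-Combinatorics.Permutations"
    "HOL-Library.FuncSet"
    "Graph_Theory.Pair_Digraph"
begin

text \<open>
  Permutations of a set are functions on the whole type that fix every point outside the set,
  so \<open>Sym \<Omega>\<close> and \<open>Sym (V - \<Omega>)\<close> are literally contained in \<open>Sym V\<close>. Permutations act on the
  right: the product \<open>g \<otimes> h\<close> means first \<open>g\<close>, then \<open>h\<close>. All action functions below nevertheless
  take the permutation as their first argument, as in \<^theory>\<open>HOL-Algebra.Group_Action\<close>;
  thus \<open>act g x\<close> stands for \<open>x\<close> to the power \<open>g\<close>.
\<close>

definition Sym :: "'a set \<Rightarrow> ('a \<Rightarrow> 'a) monoid" where
  "Sym X = \<lparr>carrier = {p. p permutes X}, monoid.mult = (\<lambda>g h. h \<circ> g), one = id\<rparr>"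

record ('a, 'l) labelled_digraph = "'a pair_pre_digraph" +
  vlabel :: "'a \<Rightarrow> 'l"
  alabel :: "'a \<times> 'a \<Rightarrow> 'l"

text \<open>
  Label functions are extensional (\<open>undefined\<close> outside the vertices and the arcs, respectively),
  so that labelled digraphs are equal as records iff they are equal mathematically.
\<close>

definition labelled_digraphs :: "'l set \<Rightarrow> 'a set \<Rightarrow> ('a, 'l) labelled_digraph set" where
  "labelled_digraphs L V = {\<Gamma>. pverts \<Gamma> = V \<and> parcs \<Gamma> \<subseteq> V \<times> V
     \<and> vlabel \<Gamma> \<in> V \<rightarrow>\<^sub>E L \<and> alabel \<Gamma> \<in> parcs \<Gamma> \<rightarrow>\<^sub>E L}"

definition rename :: "('a \<Rightarrow> 'a) \<Rightarrow> ('a, 'l) labelled_digraph \<Rightarrow> ('a, 'l) labelled_digraph" where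
  "rename g \<Gamma> = \<lparr>pverts = g ` pverts \<Gamma>, parcs = map_prod g g ` parcs \<Gamma>,
     vlabel = vlabel \<Gamma> \<circ> inv_into UNIV g,
     alabel = alabel \<Gamma> \<circ> map_prod (inv_into UNIV g) (inv_into UNIV g)\<rparr>"

definition ext_orbit ::
    "'a set \<Rightarrow> ('a, 'l) labelled_digraph \<Rightarrow> ('a, 'l) labelled_digraph set" where
  "ext_orbit \<Omega> \<Gamma> = orbit (Sym (pverts \<Gamma> - \<Omega>)) rename \<Gamma>"

definition extended_graphs ::
    "'l set \<Rightarrow> 'a set \<Rightarrow> 'a set \<Rightarrow> ('a, 'l) labelled_digraph set set" where
  "extended_graphs L \<Lambda> \<Omega> =
     {ext_orbit \<Omega> \<Gamma> | \<Gamma> V. finite V \<and> \<Omega> \<subseteq> V \<and> V \<subseteq> \<Lambda> \<and> \<Gamma> \<in> labelled_digraphs L V}"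

text \<open>
  The action on extended graphs is the one induced on sets of labelled digraphs; the lemma
  \<open>ext_act_ext_orbit\<close> below shows that it sends the orbit of \<open>\<Gamma>\<close> to the orbit of \<open>rename g \<Gamma>\<close>.
\<close>

definition ext_act ::
    "('a \<Rightarrow> 'a) \<Rightarrow> ('a, 'l) labelled_digraph set \<Rightarrow> ('a, 'l) labelled_digraph set" where
  "ext_act g X = rename g ` X"

lemma rename_comp:
  assumes "g permutes A" "h permutes B"
  shows "rename h (rename g \<Gamma>) = rename (h \<circ> g) \<Gamma>"
proof -
  have "inv_into UNIV (h \<circ> g) = inv_into UNIV g \<circ> inv_into UNIV h"
    using assms by (simp add: o_inv_distrib permutes_bij)
  then show ?thesis
    by (simp add: rename_def image_comp o_assoc [symmetric] map_prod.comp)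
qed

lemma ext_act_ext_orbit:
  fixes \<Gamma> :: "('a, 'l) labelled_digraph"
  assumes g: "g permutes \<Omega>" and "\<Omega> \<subseteq> pverts \<Gamma>"
  shows "ext_act g (ext_orbit \<Omega> \<Gamma>) = ext_orbit \<Omega> (rename g \<Gamma>)"
proof -
  have "g permutes pverts \<Gamma>"
    using assms by (rule permutes_subset)
  then have V: "pverts (rename g \<Gamma>) = pverts \<Gamma>"
    by (simp add: rename_def permutes_image)
  have comm: "rename g (rename h \<Gamma>) = rename h (rename g \<Gamma>)"
    if h: "h permutes (pverts \<Gamma> - \<Omega>)" for h
  proof -
    have "g (h x) = h (g x)" for x
    proof (cases "x \<in> \<Omega>")
      case True
      then have "g x \<in> \<Omega>"
        using g by (simp add: permutes_in_image)
      then show ?thesis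
        using True h by (simp add: permutes_not_in)
    next
      case False
      then have "h x \<notin> \<Omega>"
        using permutes_in_image [OF h, of x] permutes_not_in [OF h, of x] by auto
      then show ?thesis
        using False g by (simp add: permutes_not_in)
    qed
    then have "g \<circ> h = h \<circ> g"
      by (simp add: fun_eq_iff)
    then show ?thesis
      using rename_comp [OF h g] rename_comp [OF g h] by metis
  qed
  have "ext_orbit \<Omega> \<Delta> = (\<lambda>h. rename h \<Delta>) ` {h. h permutes (pverts \<Delta> - \<Omega>)}"
    for \<Delta> :: "('a, 'l) labelled_digraph"
    by (auto simp: ext_orbit_def orbit_def Sym_def)
  then show ?thesis
    by (simp add: ext_act_def image_image V comm)
qed

text \<open>
  In the following definitions \<open>act\<close> is an action of \<open>Sym \<Omega>\<close> on the set \<open>\<O>\<close>;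
  stacks over \<open>\<O>\<close> are the elements of \<open>lists \<O>\<close>.
\<close>

definition Transp :: "'a set \<Rightarrow> (('a \<Rightarrow> 'a) \<Rightarrow> 'x \<Rightarrow> 'x) \<Rightarrow> 'x \<Rightarrow> 'x \<Rightarrow> ('a \<Rightarrow> 'a) set" where
  "Transp \<Omega> act x y = {g \<in> carrier (Sym \<Omega>). act g x = y}"

definition stack_act :: "(('a \<Rightarrow> 'a) \<Rightarrow> 'x \<Rightarrow> 'x) \<Rightarrow> ('a \<Rightarrow> 'a) \<Rightarrow> 'x list \<Rightarrow> 'x list" where
  "stack_act act g S = map (act g) S"

definition refiner ::
    "'a set \<Rightarrow> 'x set \<Rightarrow> (('a \<Rightarrow> 'a) \<Rightarrow> 'x \<Rightarrow> 'x) \<Rightarrow> ('a \<Rightarrow> 'a) set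
      \<Rightarrow> ('x list \<Rightarrow> 'x list) \<times> ('x list \<Rightarrow> 'x list) \<Rightarrow> bool" where
  "refiner \<Omega> \<O> act U = (\<lambda>(f\<^sub>L, f\<^sub>R).
     f\<^sub>L \<in> lists \<O> \<rightarrow> lists \<O> \<and> f\<^sub>R \<in> lists \<O> \<rightarrow> lists \<O> \<and>
     (\<forall>S \<in> lists \<O>. \<forall>T \<in> lists \<O>.
        U \<inter> Transp \<Omega> (stack_act act) S T \<subseteq> Transp \<Omega> (stack_act act) (f\<^sub>L S) (f\<^sub>R T)))"

definition perfect_refiner ::
    "'a set \<Rightarrow> 'x set \<Rightarrow> (('a \<Rightarrow> 'a) \<Rightarrow> 'x \<Rightarrow> 'x) \<Rightarrow> ('a \<Rightarrow> 'a) set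
      \<Rightarrow> ('x list \<Rightarrow> 'x list) \<times> ('x list \<Rightarrow> 'x list) \<Rightarrow> bool" where
  "perfect_refiner \<Omega> \<O> act U = (\<lambda>(f\<^sub>L, f\<^sub>R).
     refiner \<Omega> \<O> act U (f\<^sub>L, f\<^sub>R) \<and>
     (\<forall>S \<in> lists \<O>. \<forall>T \<in> lists \<O>. length S = length T \<longrightarrow>
        U \<inter> Transp \<Omega> (stack_act act) S T
          = Transp \<Omega> (stack_act act) (S @ f\<^sub>L S) (T @ f\<^sub>R T)))"

end

theory Submission
  imports Defs
begin

text \<open>
  It suffices to find one extended graph with stabiliser \<open>U\<close>: pushing it onto both stacks is a
  perfect refiner. For such a graph, add one new vertex \<open>w\<close> for each element \<open>\<phi> w\<close> of \<open>U\<close> and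
  join it to every \<open>x \<in> \<Omega>\<close> by an arc labelled by a code for \<open>\<phi> w x\<close>. Up to permutation of the
  new vertices, this records the set \<open>U\<close> of functions on \<open>\<Omega>\<close>, which \<open>g\<close> maps to the coset
  \<open>{u \<circ> inv g | u \<in> U}\<close>. This coset equals \<open>U\<close> iff \<open>g \<in> U\<close>.
\<close>

lemma ext_orbit_eq_image:
  "ext_orbit \<Omega> \<Gamma> = (\<lambda>h. rename h \<Gamma>) ` {h. h permutes (pverts \<Gamma> - \<Omega>)}"
  by (auto simp: ext_orbit_def orbit_def Sym_def)

lemma rename_id [simp]: "rename id \<Gamma> = \<Gamma>" for \<Gamma> :: "('a, 'l) labelled_digraph"
  by (simp add: rename_def map_prod.id)

text \<open>Since \<open>h\<close> preserves the vertex set, the same group acts on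
  \<open>rename h \<Gamma>\<close>; renaming by \<open>k\<close> after \<open>h\<close> is renaming
  by \<open>k \<circ> h\<close>, and right translation by \<open>h\<close> permutes that
  group.\<close>

lemma ext_orbit_rename:
  fixes \<Gamma> :: "('a, 'l) labelled_digraph"
  assumes h: "h permutes (pverts \<Gamma> - \<Omega>)"
  shows "ext_orbit \<Omega> (rename h \<Gamma>) = ext_orbit \<Omega> \<Gamma>"
proof -
  let ?P = "{k. k permutes (pverts \<Gamma> - \<Omega>)}"
  have "h ` pverts \<Gamma> = pverts \<Gamma>"
    using h by (metis Diff_subset permutes_image permutes_subset)
  then have "ext_orbit \<Omega> (rename h \<Gamma>) = (\<lambda>k. rename k (rename h \<Gamma>)) ` ?P"
    by (simp add: ext_orbit_eq_image rename_def)
  also have "\<dots> = (\<lambda>k. rename (k \<circ> h) \<Gamma>) ` ?P"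
    by (rule image_cong [OF refl]) (simp add: rename_comp [OF h])
  also have "\<dots> = (\<lambda>k. rename k \<Gamma>) ` (\<lambda>k. k \<circ> h) ` ?P"
    by (simp add: image_image)
  also have "(\<lambda>k. k \<circ> h) ` ?P = ?P"
    using image_compose_permutations_right [OF h] by (auto simp: image_def)
  finally show ?thesis
    by (simp add: ext_orbit_eq_image)
qed

text \<open>Reduces fixing a whole orbit to one equation between renamings of a representative: the
  image is the orbit of \<open>rename g \<Gamma>\<close>, and two orbits coincide once they share a
  member.\<close>

lemma ext_act_fixes_ext_orbit_iff:
  fixes \<Gamma> :: "('a, 'l) labelled_digraph"
  assumes "g permutes \<Omega>" and "\<Omega> \<subseteq> pverts \<Gamma>"
  shows "ext_act g (ext_orbit \<Omega> \<Gamma>) = ext_orbit \<Omega> \<Gamma> \<longleftrightarrow>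
    (\<exists>h. h permutes (pverts \<Gamma> - \<Omega>) \<and> rename g \<Gamma> = rename h \<Gamma>)"
proof
  assume "ext_act g (ext_orbit \<Omega> \<Gamma>) = ext_orbit \<Omega> \<Gamma>"
  moreover have "\<Gamma> \<in> ext_orbit \<Omega> \<Gamma>"
    unfolding ext_orbit_eq_image
    by (rule image_eqI [of _ _ id]) (simp_all add: permutes_id)
  ultimately have "rename g \<Gamma> \<in> ext_orbit \<Omega> \<Gamma>"
    by (auto simp: ext_act_def)
  then show "\<exists>h. h permutes (pverts \<Gamma> - \<Omega>) \<and> rename g \<Gamma> = rename h \<Gamma>"
    by (auto simp: ext_orbit_eq_image)
next
  assume "\<exists>h. h permutes (pverts \<Gamma> - \<Omega>) \<and> rename g \<Gamma> = rename h \<Gamma>"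
  then show "ext_act g (ext_orbit \<Omega> \<Gamma>) = ext_orbit \<Omega> \<Gamma>"
    using assms by (auto simp: ext_act_ext_orbit ext_orbit_rename)
qed

text \<open>Supplies both the new vertices indexing \<open>U\<close> and the labels encoding the
  points of \<Omega>.\<close>

lemma ex_bij_betw_subset_infinite:
  assumes "finite A" and "infinite B"
  obtains C f where "finite C" "C \<subseteq> B" "bij_betw f C A"
  using assms by (metis finite_same_card_bij infinite_arbitrarily_large)

lemma ex_extended_graph_stabiliser:
  fixes \<Omega> \<Lambda> :: "'a set" and L :: "'l set" and U :: "('a \<Rightarrow> 'a) set"
  assumes fin: "finite \<Omega>" and inf: "infinite \<Lambda>" "\<Omega> \<subseteq> \<Lambda>" and L: "infinite L"
    and U: "subgroup U (Sym \<Omega>)"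
  shows "\<exists>X \<in> extended_graphs L \<Lambda> \<Omega>. \<forall>g. g permutes \<Omega> \<longrightarrow> (ext_act g X = X \<longleftrightarrow> g \<in> U)"
proof -
  have U_perm: "u permutes \<Omega>" if "u \<in> U" for u
    using subgroup.subset [OF U] that by (auto simp: Sym_def)
  have U_id: "id \<in> U"
    using subgroup.one_closed [OF U] by (simp add: Sym_def)
  have U_comp: "u \<circ> v \<in> U" if "u \<in> U" "v \<in> U" for u v
    \<comment> \<open>The product of \<open>Sym \<Omega>\<close> composes in reverse order, hence
      the swapped facts.\<close>
    using subgroup.m_closed [OF U that(2,1)] by (simp add: Sym_def)
  have "finite U"
    using U_perm by (intro finite_subset [OF _ finite_permutations [OF fin]]) auto
  moreover have "infinite (\<Lambda> - \<Omega>)"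
    using fin inf by simp
  ultimately obtain W \<phi> where W: "finite W" "W \<subseteq> \<Lambda> - \<Omega>" and \<phi>: "bij_betw \<phi> W U"
    by (rule ex_bij_betw_subset_infinite)
  have \<phi>_U: "\<phi> w \<in> U" if "w \<in> W" for w
    using bij_betwE [OF \<phi>] that by blast
  obtain C c' where "C \<subseteq> L" and c': "bij_betw c' C \<Omega>"
    by (rule ex_bij_betw_subset_infinite [OF fin L])
  define c where "c = inv_into C c'"
  have "bij_betw c \<Omega> C"
    unfolding c_def by (rule bij_betw_inv_into [OF c'])
  then have c: "inj_on c \<Omega>" "\<And>x. x \<in> \<Omega> \<Longrightarrow> c x \<in> L"
    using \<open>C \<subseteq> L\<close> by (auto simp: bij_betw_def)
  obtain l where l: "l \<in> L"
    using infinite_imp_nonempty [OF L] by blast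
  \<comment> \<open>All vertices share one label and every pair in
    \<open>W \<times> \<Omega>\<close> is an arc, so only the arc labels carry information about
    \<open>U\<close>. \<open>restrict\<close> makes the label functions extensional.\<close>
  define \<Gamma> :: "('a, 'l) labelled_digraph" where
    "\<Gamma> = \<lparr>pverts = \<Omega> \<union> W, parcs = W \<times> \<Omega>, vlabel = restrict (\<lambda>_. l) (\<Omega> \<union> W),
       alabel = restrict (\<lambda>(w, x). c (\<phi> w x)) (W \<times> \<Omega>)\<rparr>"
  have verts: "pverts \<Gamma> - \<Omega> = W" "\<Omega> \<subseteq> pverts \<Gamma>"
    using W by (auto simp: \<Gamma>_def)
  have \<Gamma>_in: "\<Gamma> \<in> labelled_digraphs L (\<Omega> \<union> W)"
    using l c(2) permutes_in_image [OF U_perm [OF \<phi>_U]]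
    by (auto simp: labelled_digraphs_def \<Gamma>_def)
  have stab: "(\<exists>h. h permutes W \<and> rename g \<Gamma> = rename h \<Gamma>) \<longleftrightarrow> g \<in> U"
    if g: "g permutes \<Omega>" for g
  proof
    assume "\<exists>h. h permutes W \<and> rename g \<Gamma> = rename h \<Gamma>"
    then obtain h where h: "h permutes W" and eq: "rename g \<Gamma> = rename h \<Gamma>"
      by blast
    \<comment> \<open>The vertex of the identity is the one to follow: the labels on its arcs are
      the codes of the points themselves.\<close>
    obtain w where w: "w \<in> W" "\<phi> w = id"
      using \<phi> U_id by (metis bij_betw_imp_surj_on imageE)
    have hw: "h w \<in> W"
      using h w by (simp add: permutes_in_image)
    \<comment> \<open>Compare the labels of the arc from \<open>h w\<close> to \<open>g x\<close>.
      As \<open>g\<close> fixes \<open>W\<close> and \<open>h\<close> fixes \<Omega> pointwise, it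
      is \<open>c (\<phi> (h w) x)\<close> in \<open>rename g \<Gamma>\<close> and
      \<open>c (\<phi> w (g x)) = c (g x)\<close> in \<open>rename h \<Gamma>\<close>.\<close>
    have "g x = \<phi> (h w) x" for x
    proof (cases "x \<in> \<Omega>")
      case True
      have gx: "g x \<in> \<Omega>" "\<phi> (h w) x \<in> \<Omega>"
        using True g U_perm [OF \<phi>_U [OF hw]] by (simp_all add: permutes_in_image)
      have "inv_into UNIV g (h w) = h w"
        using W hw permutes_not_in [OF permutes_inv [OF g]] by auto
      moreover have "inv_into UNIV h (g x) = g x"
        using W gx permutes_not_in [OF permutes_inv [OF h]] by auto
      moreover have "alabel (rename g \<Gamma>) (h w, g x) = alabel (rename h \<Gamma>) (h w, g x)"
        by (simp add: eq)
      ultimately have "c (\<phi> (h w) x) = c (g x)"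
        using True w hw gx g h by (simp add: rename_def \<Gamma>_def permutes_inverses)
      then show ?thesis
        using c(1) gx by (metis inj_onD)
    next
      case False
      then show ?thesis
        using g U_perm [OF \<phi>_U [OF hw]] by (simp add: permutes_not_in)
    qed
    then have "g = \<phi> (h w)"
      by blast
    then show "g \<in> U"
      using \<phi>_U [OF hw] by simp
  next
    assume gU: "g \<in> U"
    \<comment> \<open>Right translation of \<open>U\<close> by \<open>g\<close>, transported to
      \<open>W\<close> along \<phi>. The renamings must give the arc from \<open>h w\<close> to
      \<open>x\<close> the same label, that is, \<open>\<phi> (h w) (inv g x) = \<phi> w x\<close>;
      this forces \<open>\<phi> (h w) = \<phi> w \<circ> g\<close>.\<close>
    define h where "h w = (if w \<in> W then inv_into W \<phi> (\<phi> w \<circ> g) else w)" for w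
    have h_W: "h w \<in> W" and \<phi>_h: "\<phi> (h w) = \<phi> w \<circ> g" if "w \<in> W" for w
    proof -
      have "\<phi> w \<circ> g \<in> \<phi> ` W"
        using U_comp [OF \<phi>_U [OF that] gU] \<phi> by (simp add: bij_betw_def)
      then show "h w \<in> W" "\<phi> (h w) = \<phi> w \<circ> g"
        using that by (simp_all add: h_def inv_into_into f_inv_into_f)
    qed
    have "inj_on h W"
    proof (rule inj_onI)
      fix v w assume vw: "v \<in> W" "w \<in> W" "h v = h w"
      then have "\<phi> v \<circ> g = \<phi> w \<circ> g"
        using \<phi>_h by metis
      then have "\<phi> v \<circ> (g \<circ> inv_into UNIV g) = \<phi> w \<circ> (g \<circ> inv_into UNIV g)"
        by (simp only: o_assoc)
      then have "\<phi> v = \<phi> w"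
        by (simp add: permutes_inv_o [OF g])
      then show "v = w"
        using \<phi> vw by (meson bij_betw_def inj_onD)
    qed
    then have "bij_betw h W W"
      using h_W W(1) by (simp add: bij_betw_def endo_inj_surj image_subsetI)
    then have h: "h permutes W"
      by (rule bij_imp_permutes) (simp add: h_def)
    have label: "alabel \<Gamma> (inv_into UNIV g v, inv_into UNIV g x) =
        alabel \<Gamma> (inv_into UNIV h v, inv_into UNIV h x)" for v x
    proof (cases "v \<in> W \<and> x \<in> \<Omega>")
      case True
      have v: "inv_into UNIV g v = v" "inv_into UNIV h v \<in> W"
        using True W permutes_not_in [OF permutes_inv [OF g]]
          permutes_in_image [OF permutes_inv [OF h]] by auto
      have x: "inv_into UNIV h x = x" "inv_into UNIV g x \<in> \<Omega>"
        using True W permutes_not_in [OF permutes_inv [OF h]]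
          permutes_in_image [OF permutes_inv [OF g]] by auto
      have "\<phi> v = \<phi> (inv_into UNIV h v) \<circ> g"
        using \<phi>_h [OF v(2)] by (simp add: permutes_inverses [OF h])
      then have "\<phi> v (inv_into UNIV g x) = \<phi> (inv_into UNIV h v) x"
        by (simp add: permutes_inverses [OF g])
      then show ?thesis
        using True v x by (simp add: \<Gamma>_def)
    next
      case False
      \<comment> \<open>Both permutations preserve \<open>W\<close> and \<Omega>, so neither
        preimage of the pair is an arc and both labels are \<open>undefined\<close>.\<close>
      have "inv_into UNIV g v \<in> W \<longleftrightarrow> v \<in> W" "inv_into UNIV h x \<in> \<Omega> \<longleftrightarrow> x \<in> \<Omega>"
        using W permutes_inv [OF g] permutes_inv [OF h]
        by (metis Diff_iff permutes_in_image permutes_not_in subsetD)+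
      then show ?thesis
        using False permutes_in_image [OF permutes_inv [OF g]]
          permutes_in_image [OF permutes_inv [OF h]] by (auto simp: \<Gamma>_def)
    qed
    \<comment> \<open>Both renamings preserve \<Omega> and \<open>W\<close> as sets, hence also the
      vertices, the arcs and the constant vertex label; the arc labels agree by
      \<open>label\<close>.\<close>
    have "g ` \<Omega> = \<Omega>" "h ` W = W"
      using g h by (simp_all add: permutes_image)
    moreover have "g ` W = W" "h ` \<Omega> = \<Omega>"
      using W permutes_not_in [OF g] permutes_not_in [OF h] by (force simp: image_def)+
    moreover have "inv_into UNIV g x \<in> \<Omega> \<union> W \<longleftrightarrow> x \<in> \<Omega> \<union> W"
        "inv_into UNIV h x \<in> \<Omega> \<union> W \<longleftrightarrow> x \<in> \<Omega> \<union> W" for x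
      using permutes_in_image [OF permutes_subset [OF permutes_inv [OF g], of "\<Omega> \<union> W"]]
        permutes_in_image [OF permutes_subset [OF permutes_inv [OF h], of "\<Omega> \<union> W"]] by auto
    then have "vlabel \<Gamma> \<circ> inv_into UNIV g = vlabel \<Gamma> \<circ> inv_into UNIV h"
      by (simp add: \<Gamma>_def fun_eq_iff restrict_def)
    moreover have "alabel \<Gamma> \<circ> map_prod (inv_into UNIV g) (inv_into UNIV g) =
        alabel \<Gamma> \<circ> map_prod (inv_into UNIV h) (inv_into UNIV h)"
      using label by (simp add: fun_eq_iff)
    moreover have "map_prod f f ` (A \<times> B) = f ` A \<times> f ` B" for f :: "'a \<Rightarrow> 'a" and A B
      by auto
    ultimately have "rename g \<Gamma> = rename h \<Gamma>"
      unfolding rename_def by (simp add: \<Gamma>_def image_Un)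
    then show "\<exists>h. h permutes W \<and> rename g \<Gamma> = rename h \<Gamma>"
      using h by blast
  qed
  have "ext_orbit \<Omega> \<Gamma> \<in> extended_graphs L \<Lambda> \<Omega>"
    using \<Gamma>_in fin W inf unfolding extended_graphs_def by blast
  moreover have "ext_act g (ext_orbit \<Omega> \<Gamma>) = ext_orbit \<Omega> \<Gamma> \<longleftrightarrow> g \<in> U" if "g permutes \<Omega>" for g
    using stab [OF that] ext_act_fixes_ext_orbit_iff [OF that verts(2)] verts(1) by simp
  ultimately show ?thesis
    by blast
qed

text \<open>Appending the same \<open>X\<close> to both stacks adds exactly the condition
  \<open>act g X = X\<close> to the transporter, which selects the elements of \<open>U\<close>.
  Constant functions therefore suffice.\<close>

lemma perfect_refiner_stabiliser:
  assumes "X \<in> \<O>" and "U \<subseteq> carrier (Sym \<Omega>)"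
    and "\<And>g. g \<in> carrier (Sym \<Omega>) \<Longrightarrow> act g X = X \<longleftrightarrow> g \<in> U"
  shows "perfect_refiner \<Omega> \<O> act U (\<lambda>_. [X], \<lambda>_. [X])"
  using assms by (auto simp: perfect_refiner_def refiner_def Transp_def stack_act_def)

theorem lemma7p5:
  fixes \<Omega> \<Lambda> :: "'a set" and r :: "'a rel" and L :: "'l set" and U :: "('a \<Rightarrow> 'a) set"
  assumes "finite \<Omega>" and "\<Omega> \<noteq> {}"
    and "infinite \<Lambda>" and "well_order_on \<Lambda> r" and "\<Omega> \<subseteq> \<Lambda>"
    and "\<And>\<alpha> \<beta>. \<alpha> \<in> \<Omega> \<Longrightarrow> \<beta> \<in> \<Lambda> - \<Omega> \<Longrightarrow> (\<alpha>, \<beta>) \<in> r \<and> \<alpha> \<noteq> \<beta>"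
    and "infinite L"
    and "subgroup U (Sym \<Omega>)"
  shows "\<exists>f\<^sub>L f\<^sub>R. perfect_refiner \<Omega> (extended_graphs L \<Lambda> \<Omega>) ext_act U (f\<^sub>L, f\<^sub>R)"
proof -
  obtain X where X: "X \<in> extended_graphs L \<Lambda> \<Omega>"
    "\<And>g. g permutes \<Omega> \<Longrightarrow> ext_act g X = X \<longleftrightarrow> g \<in> U"
    using ex_extended_graph_stabiliser [OF assms(1,3,5,7,8)] by blast
  have "perfect_refiner \<Omega> (extended_graphs L \<Lambda> \<Omega>) ext_act U (\<lambda>_. [X], \<lambda>_. [X])"
    using X by (intro perfect_refiner_stabiliser subgroup.subset assms) (simp_all add: Sym_def)
  then show ?thesis
    by blast
qed

end
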